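(* Let $A$ be an $m\times n$ matrix with integer entries, $n>m$, ${\rm rank}(A)=m$, columns ${\bf a}_1,\ldots,{\bf a}_n$, ${\bf b}\in\mathbb{R}^m$, and let $X$ be the maximum-entropy random vector described in the context, with parameters $q_j$. Suppose $n=pm$, that ${\bf a}_{(k-1)m+1},\ldots,{\bf a}_{km}$ are linearly independent for $1\leq k\leq p$, and that $\langle{\bf a}_j,{\bf b}\rangle>0$ for all $j$. Let $\gamma>0$ and define $\alpha_j:=\frac{2q_j}{(1-q_j)^2}$, $\alpha^\vee_i:=\min_{1\leq k\leq p}\alpha_{(k-1)m+i}$, $q^\vee_i:=\min_{1\leq k\leq p}q_{(k-1)m+i}$, $$c_i:=\max\Big\{\frac{1}{\gamma^2}\ln\Big[1+\alpha^\vee_i\big(1-\cos\tfrac{\gamma}{\sqrt{\alpha^\vee_i}}\big)\Big],\ \frac{1}{\alpha^\vee_i\pi^2}\ln\big[1+2\alpha^\vee_i\big]\Big\},$$ $C:=\prod_{i=1}^m(2\pi c_i\alpha^\vee_i)^{-1/2}$ and $C':=\max_{i}e^{-\gamma^2c_i/2}$. Then $$C\leq\Bigg[\frac{\gamma}{2\sqrt{\pi\ln\big(1+\frac{2\gamma^2}{\pi^2}\big)}}\Bigg]^m\prod_{i=1}^m\frac{1-q^\vee_i}{\sqrt{q^\vee_i}}\qquad\text{and}\qquad C'\leq\frac{1}{\sqrt{1+\frac{2\gamma^2}{\pi^2}}}.$$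
   Context: $X=(X_1,\ldots,X_n)$ is the random vector with values in $\mathbb{Z}_{\geq 0}^n$ of maximum entropy subject to ${\bf E}[AX]={\bf b}$ (assumed to exist). Its coordinates are independent and geometrically distributed: ${\bf Pr}[X_j=k]=(1-q_j)q_j^k$, $q_j\in[0,1)$.
   Formalization: The formal statement additionally assumes α^∨_i ≠ 0 (equivalently q^∨_i > 0) for all i; the other hypotheses allow q_j = 0, in which case c_i, C and the product with 1/√q^∨_i involve division by zero and are undefined. *)

theory Defs
  imports "HOL-Probability.Probability" "Jordan_Normal_Form.DL_Rank"
begin

unbundle no vec_syntax
no_notation inner (infix "\<bullet>" 70)

text \<open>
  Random vectors with values in the nonnegative integer vectors of dimension \<open>n\<close> are represented
  by their laws, i.e. by probability mass functions on \<open>nat\<close>-vectors supported on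
  \<open>carrier_vec n\<close>. Coordinates and columns are numbered from 0.
\<close>

abbreviation real_mat :: "int mat \<Rightarrow> real mat" where
  "real_mat \<equiv> map_mat real_of_int"

text \<open>Shannon entropy in nats, \<open>\<Sum>\<^sub>x - P(x) ln P(x)\<close>, with value \<open>\<infinity>\<close> if the series diverges.\<close>

definition shannon_entropy :: "'a pmf \<Rightarrow> ennreal" where
  "shannon_entropy P = (\<integral>\<^sup>+ x. ennreal (- ln (pmf P x)) \<partial>measure_pmf P)"

definition mean_constraint :: "int mat \<Rightarrow> real Matrix.vec \<Rightarrow> nat Matrix.vec pmf \<Rightarrow> bool" where
  "mean_constraint A b P \<longleftrightarrow>
     set_pmf P \<subseteq> carrier_vec (dim_col A) \<and>
     (\<forall>i<dim_row A.
        integrable (measure_pmf P) (\<lambda>x. (real_mat A *\<^sub>v map_vec real x) $ i) \<and>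
        measure_pmf.expectation P (\<lambda>x. (real_mat A *\<^sub>v map_vec real x) $ i) = b $ i)"

definition max_entropy :: "int mat \<Rightarrow> real Matrix.vec \<Rightarrow> nat Matrix.vec pmf \<Rightarrow> bool" where
  "max_entropy A b P \<longleftrightarrow>
     mean_constraint A b P \<and>
     (\<forall>Q. mean_constraint A b Q \<longrightarrow> shannon_entropy Q \<le> shannon_entropy P)"

definition independent_geometric :: "nat \<Rightarrow> (nat \<Rightarrow> real) \<Rightarrow> nat Matrix.vec pmf \<Rightarrow> bool" where
  "independent_geometric n q P \<longleftrightarrow>
     prob_space.indep_vars (measure_pmf P) (\<lambda>_. count_space UNIV) (\<lambda>j x. x $ j) {..<n} \<and>
     (\<forall>j<n. 0 \<le> q j \<and> q j < 1 \<and>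
        (\<forall>k. measure_pmf.prob P {x. x $ j = k} = (1 - q j) * q j ^ k))"

text \<open>
  Linear independence of a list of vectors as a family: the library notion is about sets,
  so repetitions have to be excluded separately.
\<close>

definition lin_indpt_family :: "nat \<Rightarrow> real Matrix.vec list \<Rightarrow> bool" where
  "lin_indpt_family m vs \<longleftrightarrow>
     distinct vs \<and> module.lin_indpt class_ring (module_vec TYPE(real) m) (set vs)"

definition alpha :: "(nat \<Rightarrow> real) \<Rightarrow> nat \<Rightarrow> real" where
  "alpha q j = 2 * q j / (1 - q j)\<^sup>2"

definition block_min :: "nat \<Rightarrow> nat \<Rightarrow> (nat \<Rightarrow> real) \<Rightarrow> nat \<Rightarrow> real" where
  "block_min p m f i = Min ((\<lambda>k. f (k * m + i)) ` {..<p})"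

abbreviation alpha_vee :: "nat \<Rightarrow> nat \<Rightarrow> (nat \<Rightarrow> real) \<Rightarrow> nat \<Rightarrow> real" where
  "alpha_vee p m q \<equiv> block_min p m (alpha q)"

abbreviation q_vee :: "nat \<Rightarrow> nat \<Rightarrow> (nat \<Rightarrow> real) \<Rightarrow> nat \<Rightarrow> real" where
  "q_vee p m q \<equiv> block_min p m q"

definition c_coeff :: "real \<Rightarrow> nat \<Rightarrow> nat \<Rightarrow> (nat \<Rightarrow> real) \<Rightarrow> nat \<Rightarrow> real" where
  "c_coeff \<gamma> p m q i =
     (let a = alpha_vee p m q i in
      max (1 / \<gamma>\<^sup>2 * ln (1 + a * (1 - cos (\<gamma> / sqrt a))))
          (1 / (a * pi\<^sup>2) * ln (1 + 2 * a)))"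

definition C_const :: "real \<Rightarrow> nat \<Rightarrow> nat \<Rightarrow> (nat \<Rightarrow> real) \<Rightarrow> real" where
  "C_const \<gamma> p m q =
     (\<Prod>i<m. (2 * pi * c_coeff \<gamma> p m q i * alpha_vee p m q i) powr (- 1 / 2))"

definition C'_const :: "real \<Rightarrow> nat \<Rightarrow> nat \<Rightarrow> (nat \<Rightarrow> real) \<Rightarrow> real" where
  "C'_const \<gamma> p m q = Max ((\<lambda>i. exp (- (\<gamma>\<^sup>2 * c_coeff \<gamma> p m q i) / 2)) ` {..<m})"

end

theory Submission
  imports Defs
begin

text \<open>
  Both estimates follow from \<open>\<gamma>\<^sup>2 c\<^sub>i \<ge> ln (1 + 2 \<gamma>\<^sup>2 / \<pi>\<^sup>2)\<close>. If \<open>\<gamma> \<le> \<pi> \<surd>\<alpha>\<close>, where \<open>\<alpha>\<close> is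
  \<open>\<alpha>\<^sup>\<or>\<^sub>i\<close>, the first term of the maximum is large enough, since \<open>1 - cos x \<ge> 2 x\<^sup>2 / \<pi>\<^sup>2\<close> on
  \<open>[0, \<pi>]\<close>. Otherwise \<open>\<alpha> < \<gamma>\<^sup>2 / \<pi>\<^sup>2\<close>, and the second term is large enough, since
  \<open>t \<mapsto> ln (1 + 2 t) / t\<close> is decreasing. As \<open>q \<mapsto> 2 q / (1 - q)\<^sup>2\<close> is increasing, \<open>\<alpha>\<^sup>\<or>\<^sub>i\<close> is its value at
  \<open>q\<^sup>\<or>\<^sub>i\<close>.
\<close>

text \<open>Jordan's inequality: sine is concave on the interval, so its graph lies above the chord
  joining (0, 0) to (pi/2, 1).\<close>

lemma sin_ge_two_over_pi_mult:
  fixes x :: real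
  assumes "0 \<le> x" "x \<le> pi / 2"
  shows "2 * x / pi \<le> sin x"
proof -
  have "concave_on {0..pi / 2} (sin :: real \<Rightarrow> real)"
    by (rule f''_le0_imp_concave[where f' = cos and f'' = "\<lambda>x. - sin x"])
       (auto intro!: derivative_eq_intros sin_ge_zero)
  from concave_onD_Icc'[OF this, of x] assms show ?thesis
    by simp
qed

text \<open>Jordan's inequality at x/2, squared, combined with 1 - cos x = 2 sin(x/2)^2.\<close>

lemma one_minus_cos_ge_square:
  fixes x :: real
  assumes "0 \<le> x" "x \<le> pi"
  shows "2 * x\<^sup>2 / pi\<^sup>2 \<le> 1 - cos x"
proof -
  have "x / pi \<le> sin (x / 2)"
    using sin_ge_two_over_pi_mult[of "x / 2"] assms by simp
  hence "(x / pi)\<^sup>2 \<le> (sin (x / 2))\<^sup>2"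
    using assms by (intro power_mono) auto
  moreover have "cos x = 1 - 2 * (sin (x / 2))\<^sup>2"
    using cos_double_sin[of "x / 2"] by simp
  ultimately show ?thesis
    by (simp add: power_divide)
qed

text \<open>The quotient is the slope of the chord from 0 to s of the concave function u -> ln (1 +
  r u), which vanishes at 0; such slopes decrease.\<close>

lemma ln_one_plus_mult_div_antimono:
  fixes r s t :: real
  assumes "0 \<le> r" "0 < t" "t \<le> s"
  shows "ln (1 + r * s) / s \<le> ln (1 + r * t) / t"
proof -
  have eq: "(1 - t / s) *\<^sub>R 1 + (t / s) *\<^sub>R (1 + r * s) = 1 + r * t"
    using assms by (simp add: field_simps)
  have "(1 - t / s) * ln 1 + (t / s) * ln (1 + r * s) \<le> ln ((1 - t / s) *\<^sub>R 1 + (t / s) *\<^sub>R (1 + r * s))"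
    using assms by (intro concave_onD[OF ln_concave]) (auto intro: add_pos_nonneg)
  hence "(t / s) * ln (1 + r * s) \<le> ln (1 + r * t)"
    unfolding eq by simp
  thus ?thesis
    using assms by (simp add: field_simps)
qed

lemma max_log_coefficient_ge:
  fixes a \<gamma> :: real
  assumes "0 < a" "0 < \<gamma>"
  shows "ln (1 + 2 * \<gamma>\<^sup>2 / pi\<^sup>2) / \<gamma>\<^sup>2
    \<le> max (1 / \<gamma>\<^sup>2 * ln (1 + a * (1 - cos (\<gamma> / sqrt a)))) (1 / (a * pi\<^sup>2) * ln (1 + 2 * a))"
proof (cases "\<gamma> / sqrt a \<le> pi")
  case True
  have "2 * (\<gamma> / sqrt a)\<^sup>2 / pi\<^sup>2 \<le> 1 - cos (\<gamma> / sqrt a)"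
    using assms True by (intro one_minus_cos_ge_square) auto
  hence "a * (2 * (\<gamma> / sqrt a)\<^sup>2 / pi\<^sup>2) \<le> a * (1 - cos (\<gamma> / sqrt a))"
    using assms by (intro mult_left_mono) auto
  hence "2 * \<gamma>\<^sup>2 / pi\<^sup>2 \<le> a * (1 - cos (\<gamma> / sqrt a))"
    using assms by (simp add: power_divide)
  moreover have "0 < 2 * \<gamma>\<^sup>2 / pi\<^sup>2"
    using assms by simp
  ultimately have "ln (1 + 2 * \<gamma>\<^sup>2 / pi\<^sup>2) \<le> ln (1 + a * (1 - cos (\<gamma> / sqrt a)))"
    by (subst ln_le_cancel_iff) linarith+
  hence "ln (1 + 2 * \<gamma>\<^sup>2 / pi\<^sup>2) / \<gamma>\<^sup>2 \<le> 1 / \<gamma>\<^sup>2 * ln (1 + a * (1 - cos (\<gamma> / sqrt a)))"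
    using assms by (simp add: divide_right_mono)
  thus ?thesis
    by (rule max.coboundedI1)
next
  case False
  hence "pi * sqrt a < \<gamma>"
    using assms by (simp add: field_simps)
  hence "(pi * sqrt a)\<^sup>2 < \<gamma>\<^sup>2"
    using assms by (intro power_strict_mono) auto
  hence "a \<le> \<gamma>\<^sup>2 / pi\<^sup>2"
    using assms by (simp add: field_simps)
  \<comment> \<open>Slopes with r = 2 are compared at t = a and s =
    \<open>\<gamma>\<^sup>2 / pi\<^sup>2\<close>; the later division by \<open>pi\<^sup>2\<close>
    turns the left denominator into \<open>\<gamma>\<^sup>2\<close>.\<close>
  hence "ln (1 + 2 * (\<gamma>\<^sup>2 / pi\<^sup>2)) / (\<gamma>\<^sup>2 / pi\<^sup>2) \<le> ln (1 + 2 * a) / a"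
    using assms by (intro ln_one_plus_mult_div_antimono) auto
  hence "ln (1 + 2 * (\<gamma>\<^sup>2 / pi\<^sup>2)) / (\<gamma>\<^sup>2 / pi\<^sup>2) / pi\<^sup>2 \<le> ln (1 + 2 * a) / a / pi\<^sup>2"
    by (intro divide_right_mono) auto
  hence "ln (1 + 2 * \<gamma>\<^sup>2 / pi\<^sup>2) / \<gamma>\<^sup>2 \<le> 1 / (a * pi\<^sup>2) * ln (1 + 2 * a)"
    by simp
  thus ?thesis
    by (rule max.coboundedI2)
qed

lemma block_min_attained:
  assumes "0 < p"
  obtains k where "k < p" "block_min p m f i = f (k * m + i)"
proof -
  have "block_min p m f i \<in> (\<lambda>k. f (k * m + i)) ` {..<p}"
    unfolding block_min_def using assms by (intro Min_in) auto
  thus ?thesis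
    using that by auto
qed

lemma block_min_le:
  assumes "k < p"
  shows "block_min p m f i \<le> f (k * m + i)"
  unfolding block_min_def using assms by (intro Min_le) auto

lemma two_mult_div_one_minus_square_mono:
  fixes x y :: real
  assumes "0 \<le> x" "x \<le> y" "y < 1"
  shows "2 * x / (1 - x)\<^sup>2 \<le> 2 * y / (1 - y)\<^sup>2"
  using assms by (intro frac_le power_mono zero_less_power mult_left_mono) auto

lemma alpha_vee_eq:
  assumes "0 < p" and q: "\<And>k. k < p \<Longrightarrow> 0 \<le> q (k * m + i) \<and> q (k * m + i) < 1"
  shows "alpha_vee p m q i = 2 * q_vee p m q i / (1 - q_vee p m q i)\<^sup>2"
proof (rule antisym)
  \<comment> \<open>The two minimizers k and l need not coincide: k yields the upper bound on
    \<open>alpha_vee\<close>, and l with monotonicity the lower bound.\<close>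
  obtain k where k: "k < p" "q_vee p m q i = q (k * m + i)"
    using block_min_attained[OF \<open>0 < p\<close>] .
  obtain l where l: "l < p" "alpha_vee p m q i = alpha q (l * m + i)"
    using block_min_attained[OF \<open>0 < p\<close>] .
  show "alpha_vee p m q i \<le> 2 * q_vee p m q i / (1 - q_vee p m q i)\<^sup>2"
    using block_min_le[OF k(1), of m "alpha q" i] by (simp add: alpha_def k(2))
  have "2 * q_vee p m q i / (1 - q_vee p m q i)\<^sup>2 \<le> 2 * q (l * m + i) / (1 - q (l * m + i))\<^sup>2"
    using q[OF k(1)] q[OF l(1)] block_min_le[OF l(1), of m q i] k(2)
    by (intro two_mult_div_one_minus_square_mono) auto
  thus "2 * q_vee p m q i / (1 - q_vee p m q i)\<^sup>2 \<le> alpha_vee p m q i"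
    by (simp add: l(2) alpha_def)
qed

theorem mainTheorem7:
  fixes A :: "int mat" and b :: "real Matrix.vec" and P :: "nat Matrix.vec pmf"
    and q :: "nat \<Rightarrow> real" and m n p :: nat and \<gamma> :: real
  assumes "A \<in> carrier_mat m n"
    and "b \<in> carrier_vec m"
    and "n > m"
    and "vec_space.rank m (real_mat A) = m"
    and "max_entropy A b P"
    and "independent_geometric n q P"
    and "n = p * m"
    and "\<And>k. k < p \<Longrightarrow> lin_indpt_family m (map (col (real_mat A)) [k * m ..< (k + 1) * m])"
    and "\<And>j. j < n \<Longrightarrow> col (real_mat A) j \<bullet> b > 0"
    and "\<gamma> > 0"
    \<comment> \<open>the quantities \<open>c\<^sub>i\<close> divide by \<open>\<alpha>\<^sup>\<or>\<^sub>i\<close>, hence are only defined under this condition\<close>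
    and "\<And>i. i < m \<Longrightarrow> alpha_vee p m q i \<noteq> 0"
  shows "C_const \<gamma> p m q
           \<le> (\<gamma> / (2 * sqrt (pi * ln (1 + 2 * \<gamma>\<^sup>2 / pi\<^sup>2)))) ^ m
              * (\<Prod>i<m. (1 - q_vee p m q i) / sqrt (q_vee p m q i))
         \<and> C'_const \<gamma> p m q \<le> 1 / sqrt (1 + 2 * \<gamma>\<^sup>2 / pi\<^sup>2)"
proof
  define L where "L = ln (1 + 2 * \<gamma>\<^sup>2 / pi\<^sup>2)"
  \<comment> \<open>Otherwise n = p * m = 0, against n > m. Hence the block minima and the maximum
    in \<open>C'_const\<close> range over nonempty sets.\<close>
  have "m > 0" "p > 0"
    using assms(3,7) by (auto intro: Nat.gr0I)
  have arg_pos: "0 < 2 * \<gamma>\<^sup>2 / pi\<^sup>2"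
    using \<open>\<gamma> > 0\<close> by simp
  hence "L > 0"
    unfolding L_def by (intro ln_gt_zero) linarith
  have q_bounds: "0 \<le> q (k * m + i) \<and> q (k * m + i) < 1" if "k < p" "i < m" for k i
  proof -
    have "k * m + i < Suc k * m"
      using that by simp
    also have "\<dots> \<le> n"
      unfolding \<open>n = p * m\<close> using that by (intro mult_le_mono1) auto
    finally show ?thesis
      using assms(6) by (auto simp: independent_geometric_def)
  qed
  have q_vee: "0 < q_vee p m q i \<and> q_vee p m q i < 1" if "i < m" for i
  proof -
    obtain k where k: "k < p" "q_vee p m q i = q (k * m + i)"
      using block_min_attained[OF \<open>p > 0\<close>] .
    \<comment> \<open>A zero here would make \<open>alpha_vee\<close> zero as well, which is
      excluded.\<close>
    have "q_vee p m q i \<noteq> 0"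
      using assms(11)[OF that] alpha_vee_eq[OF \<open>p > 0\<close>, of q m i] q_bounds that by auto
    thus ?thesis
      using q_bounds[OF k(1) that] k(2) by auto
  qed
  have alpha_vee: "alpha_vee p m q i = 2 * q_vee p m q i / (1 - q_vee p m q i)\<^sup>2" if "i < m" for i
    using alpha_vee_eq[OF \<open>p > 0\<close>] q_bounds that by blast
  have alpha_pos: "0 < alpha_vee p m q i" if "i < m" for i
    using q_vee[OF that] by (simp add: alpha_vee[OF that])
  have c_ge: "L / \<gamma>\<^sup>2 \<le> c_coeff \<gamma> p m q i" if "i < m" for i
    using max_log_coefficient_ge[OF alpha_pos[OF that] \<open>\<gamma> > 0\<close>]
    by (simp add: c_coeff_def L_def Let_def)

  have "C_const \<gamma> p m q
      \<le> (\<Prod>i<m. \<gamma> / (2 * sqrt (pi * L)) * ((1 - q_vee p m q i) / sqrt (q_vee p m q i)))"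
    unfolding C_const_def
  proof (intro prod_mono conjI)
    fix i assume "i \<in> {..<m}"
    hence i: "i < m" by simp
    let ?a = "alpha_vee p m q i" and ?q = "q_vee p m q i"
    have pos: "0 < 2 * pi * (L / \<gamma>\<^sup>2) * ?a"
      using \<open>L > 0\<close> \<open>\<gamma> > 0\<close> alpha_pos[OF i] by simp
    have "2 * pi * (L / \<gamma>\<^sup>2) * ?a \<le> 2 * pi * c_coeff \<gamma> p m q i * ?a"
      using c_ge[OF i] alpha_pos[OF i] by (intro mult_right_mono mult_left_mono) auto
    \<comment> \<open>The exponent is negative, so the lower bound on \<open>c_coeff\<close> becomes
      an upper bound on the factor.\<close>
    hence "(2 * pi * c_coeff \<gamma> p m q i * ?a) powr (- 1 / 2) \<le> (2 * pi * (L / \<gamma>\<^sup>2) * ?a) powr (- 1 / 2)"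
      using pos by (intro powr_mono2') auto
    also have "\<dots> = 1 / sqrt (2 * pi * (L / \<gamma>\<^sup>2) * ?a)"
      using pos by (simp add: powr_minus_divide powr_half_sqrt)
    \<comment> \<open>Substituting the formula for \<open>alpha_vee\<close> isolates a perfect
      square; its root needs no absolute value because \<open>?q < 1\<close> and \<gamma> >
      0.\<close>
    also have "2 * pi * (L / \<gamma>\<^sup>2) * ?a = (2 / (\<gamma> * (1 - ?q)))\<^sup>2 * (pi * L * ?q)"
      by (simp add: alpha_vee[OF i] power_divide power_mult_distrib)
    also have "sqrt \<dots> = 2 / (\<gamma> * (1 - ?q)) * (sqrt (pi * L) * sqrt ?q)"
      using q_vee[OF i] \<open>\<gamma> > 0\<close> by (simp add: real_sqrt_mult)
    also have "1 / \<dots> = \<gamma> / (2 * sqrt (pi * L)) * ((1 - ?q) / sqrt ?q)"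
      by simp
    finally show "(2 * pi * c_coeff \<gamma> p m q i * ?a) powr (- 1 / 2)
        \<le> \<gamma> / (2 * sqrt (pi * L)) * ((1 - ?q) / sqrt ?q)" .
  qed simp
  also have "\<dots> = (\<gamma> / (2 * sqrt (pi * L))) ^ m * (\<Prod>i<m. (1 - q_vee p m q i) / sqrt (q_vee p m q i))"
    by (subst prod.distrib) simp
  finally show "C_const \<gamma> p m q
      \<le> (\<gamma> / (2 * sqrt (pi * ln (1 + 2 * \<gamma>\<^sup>2 / pi\<^sup>2)))) ^ m
         * (\<Prod>i<m. (1 - q_vee p m q i) / sqrt (q_vee p m q i))"
    by (simp only: L_def)

  have "exp (- (\<gamma>\<^sup>2 * c_coeff \<gamma> p m q i) / 2) \<le> 1 / sqrt (1 + 2 * \<gamma>\<^sup>2 / pi\<^sup>2)" if "i < m" for i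
  proof -
    have "exp (- (\<gamma>\<^sup>2 * c_coeff \<gamma> p m q i) / 2) \<le> exp (- (L / 2))"
      using c_ge[OF that] \<open>\<gamma> > 0\<close> by (simp add: field_simps)
    \<comment> \<open>L is the logarithm of the radicand, so L / 2 is the logarithm of its
      root.\<close>
    also have "\<dots> = 1 / sqrt (1 + 2 * \<gamma>\<^sup>2 / pi\<^sup>2)"
    proof -
      have "ln (sqrt (1 + 2 * \<gamma>\<^sup>2 / pi\<^sup>2)) = L / 2"
        unfolding L_def using arg_pos by (intro ln_sqrt) linarith
      moreover have "0 < sqrt (1 + 2 * \<gamma>\<^sup>2 / pi\<^sup>2)"
        using arg_pos unfolding real_sqrt_gt_0_iff by linarith
      ultimately show ?thesis
        by (metis exp_ln exp_minus inverse_eq_divide)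
    qed
    finally show ?thesis .
  qed
  thus "C'_const \<gamma> p m q \<le> 1 / sqrt (1 + 2 * \<gamma>\<^sup>2 / pi\<^sup>2)"
    unfolding C'_const_def using \<open>m > 0\<close> by (intro Max.boundedI) auto
qed

end
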